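(* Let $T\ge 1$ and $a_1,\dots,a_T>0$. The function $C(\lambda;T)$ (regarded as a rational function of $\lambda$ on $\mathbb{C}$ by unique extension from $\sigma_{ell}(J_T)$) is a rational function of $\lambda$ of order $1$. Moreover, its asymptotic behaviour is given by $$C(\lambda;T)\sim \frac{1}{2}\left(a_1^{-1}+\dots+a_T^{-1}\right)\lambda,\qquad \lambda\to\infty .$$
   Context: Let $T\ge1$, $a_1,\dots,a_T>0$, extended periodically by $a_{n+T}=a_n$, so in particular $a_0=a_T$. $J_T$ is the $T$-periodic Jacobi operator on $l^2(\mathbb{N};\mathbb{C})$ with zero diagonal and off-diagonal entries $a_1,a_2,\dots$. For $\lambda\in\mathbb{C}$ and $j\in\{1,\dots,T\}$ put $$B_j(\lambda)=\begin{pmatrix}0&1\\ -\frac{a_{j-1}}{a_j}&\frac{\lambda}{a_j}\end{pmatrix},\qquad M(\lambda)=B_T(\lambda)B_{T-1}(\lambda)\cdots B_1(\lambda)=\begin{pmatrix}m_{11}(\lambda)&m_{12}(\lambda)\\ m_{21}(\lambda)&m_{22}(\lambda)\end{pmatrix}.$$ $\sigma_{ell}(J_T)$ is the set of elliptic points, i.e. of those $\lambda\in\mathbb{C}$ for which $M(\lambda)$ has two distinct eigenvalues of modulus one; equivalently, the set of real $\lambda$ with $|\mathrm{Tr}\,M(\lambda)|<2$. For $\lambda\in\sigma_{ell}(J_T)$ the eigenvalues of $M(\lambda)$ are $\mu(\lambda)=e^{i\theta(\lambda)}$ and $\overline{\mu(\lambda)}=e^{-i\theta(\lambda)}$ with $\theta(\lambda)$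 real (the quasi-momentum), and $m_{12}(\lambda)\ne0$. Define $\varphi_0=1$, $\varphi_1(\lambda)=(\mu(\lambda)-m_{11}(\lambda))/m_{12}(\lambda)$ (so that $(\varphi_0,\varphi_1)^{\top}$ is an eigenvector of $M(\lambda)$ for the eigenvalue $\mu(\lambda)$), and define $\varphi_2,\dots,\varphi_T$ by $a_{s-1}\varphi_{s-1}+a_s\varphi_{s+1}=\lambda\varphi_s$, $s=1,\dots,T-1$. For $\lambda\in\sigma_{ell}(J_T)$ set $$C(\lambda;T)=\mathrm{Re}\left(\sum_{s=1}^{T}\varphi_s(\lambda)\overline{\varphi_{s-1}(\lambda)}\right);$$ this does not depend on which of the two eigenvalues is called $\mu$. The function $C(\cdot\,;T)$ on $\sigma_{ell}(J_T)$ coincides with a rational function of $\lambda$, which is unique, and the same notation is used for that rational function on $\mathbb{C}$. The order of a rational function $P/Q$ ($P,Q$ polynomials) is $\deg P-\deg Q$. *)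

theory Defs
  imports
    "Jordan_Normal_Form.Char_Poly"
    "HOL-Computational_Algebra.Field_as_Ring"
    "HOL-Computational_Algebra.Polynomial_Factorial"
    "HOL-Computational_Algebra.Normalized_Fraction"
    "HOL-Library.Landau_Symbols"
    "HOL-Analysis.Analysis"
begin

text \<open>
  The weights are a sequence \<open>a :: nat \<Rightarrow> real\<close> of period \<open>T\<close>. Only the entries \<open>a 1, \<dots>, a T\<close>
  are free; \<open>a 0 = a T\<close> is a consequence of periodicity. Matrix indices start at \<open>0\<close>, so the
  entry \<open>m\<^sub>1\<^sub>2\<close> of the monodromy matrix is \<open>$$ (0, 1)\<close>.
\<close>

definition transfer_mat :: "(nat \<Rightarrow> real) \<Rightarrow> nat \<Rightarrow> complex \<Rightarrow> complex mat" where
  "transfer_mat a j z = mat_of_rows_list 2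
     [[0, 1],
      [- complex_of_real (a (j - 1) / a j), z / complex_of_real (a j)]]"

primrec transfer_prod :: "(nat \<Rightarrow> real) \<Rightarrow> nat \<Rightarrow> complex \<Rightarrow> complex mat" where
  "transfer_prod a 0 z = 1\<^sub>m 2"
| "transfer_prod a (Suc n) z = transfer_mat a (Suc n) z * transfer_prod a n z"

definition monodromy :: "(nat \<Rightarrow> real) \<Rightarrow> nat \<Rightarrow> complex \<Rightarrow> complex mat" where
  "monodromy a T z = transfer_prod a T z"

definition sigma_ell :: "(nat \<Rightarrow> real) \<Rightarrow> nat \<Rightarrow> complex set" where
  "sigma_ell a T = {z. \<exists>\<mu> \<nu>. \<mu> \<noteq> \<nu> \<and> cmod \<mu> = 1 \<and> cmod \<nu> = 1 \<and>
     eigenvalue (monodromy a T z) \<mu> \<and> eigenvalue (monodromy a T z) \<nu>}"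

text \<open>
  The last equation is the recursion
  \<open>a (s - 1) * \<phi> (s - 1) + a s * \<phi> (s + 1) = z * \<phi> s\<close> at \<open>s = n + 1\<close>, solved for \<open>\<phi> (s + 1)\<close>.
\<close>

fun phi :: "(nat \<Rightarrow> real) \<Rightarrow> nat \<Rightarrow> complex \<Rightarrow> complex \<Rightarrow> nat \<Rightarrow> complex" where
  "phi a T z \<mu> 0 = 1"
| "phi a T z \<mu> (Suc 0) = (\<mu> - monodromy a T z $$ (0, 0)) / monodromy a T z $$ (0, 1)"
| "phi a T z \<mu> (Suc (Suc n)) =
     (z * phi a T z \<mu> (Suc n) - complex_of_real (a n) * phi a T z \<mu> n) / complex_of_real (a (Suc n))"

definition C_ell :: "(nat \<Rightarrow> real) \<Rightarrow> nat \<Rightarrow> complex \<Rightarrow> complex \<Rightarrow> real" where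
  "C_ell a T z \<mu> = Re (\<Sum>s=1..T. phi a T z \<mu> s * cnj (phi a T z \<mu> (s - 1)))"

text \<open>
  Rational functions are elements of \<open>complex poly fract\<close>; \<open>quot_of_fract\<close> returns numerator and
  denominator in lowest terms. At a pole, \<open>ratfun_eval\<close> has the junk value \<open>0\<close>.
\<close>

definition ratfun_num :: "complex poly fract \<Rightarrow> complex poly" where
  "ratfun_num R = fst (quot_of_fract R)"

definition ratfun_denom :: "complex poly fract \<Rightarrow> complex poly" where
  "ratfun_denom R = snd (quot_of_fract R)"

definition ratfun_eval :: "complex poly fract \<Rightarrow> complex \<Rightarrow> complex" where
  "ratfun_eval R z = poly (ratfun_num R) z / poly (ratfun_denom R) z"

definition ratfun_order :: "complex poly fract \<Rightarrow> int" where
  "ratfun_order R = int (degree (ratfun_num R)) - int (degree (ratfun_denom R))"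

text \<open>
  Agreement is required for either choice of the eigenvalue \<open>\<mu>\<close>, so an \<open>R\<close> with this property
  can exist only if \<open>C_ell a T z \<mu>\<close> does not depend on that choice.
\<close>

definition extends_C :: "(nat \<Rightarrow> real) \<Rightarrow> nat \<Rightarrow> complex poly fract \<Rightarrow> bool" where
  "extends_C a T R \<longleftrightarrow> (\<forall>z \<in> sigma_ell a T. poly (ratfun_denom R) z \<noteq> 0 \<and>
     (\<forall>\<mu>. eigenvalue (monodromy a T z) \<mu> \<longrightarrow>
       ratfun_eval R z = complex_of_real (C_ell a T z \<mu>)))"

definition C_rat :: "(nat \<Rightarrow> real) \<Rightarrow> nat \<Rightarrow> complex poly fract" where
  "C_rat a T = (THE R. extends_C a T R)"

end

theory Submission
  imports Defs
begin

text \<open>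
  With \<open>\<mu> + cnj \<mu> = m\<^sub>1\<^sub>1 + m\<^sub>2\<^sub>2\<close> and determinant one, \<open>Re \<phi>\<^sub>1 = (m\<^sub>2\<^sub>2 - m\<^sub>1\<^sub>1) / (2 m\<^sub>1\<^sub>2)\<close> on the
  elliptic set. The same formula at the site \<open>s\<close>, for the monodromy matrix \<open>M\<^sup>(\<^sup>s\<^sup>)\<close> of the weights
  shifted by \<open>s\<close>, shows that \<open>C\<close> is the sum over \<open>s < T\<close> of
  \<open>(a\<^sub>0 / a\<^sub>s) (m\<^sub>2\<^sub>2\<^sup>(\<^sup>s\<^sup>) - m\<^sub>1\<^sub>1\<^sup>(\<^sup>s\<^sup>)) / (2 m\<^sub>1\<^sub>2)\<close>. Here \<open>m\<^sub>2\<^sub>2\<^sup>(\<^sup>s\<^sup>)\<close> has degree \<open>T\<close> with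
  leading coefficient \<open>1 / (a\<^sub>1 \<cdots> a\<^sub>T)\<close>, \<open>m\<^sub>1\<^sub>1\<^sup>(\<^sup>s\<^sup>)\<close> has lower degree, and \<open>m\<^sub>1\<^sub>2\<close> has degree
  \<open>T - 1\<close> with leading coefficient \<open>1 / (a\<^sub>1 \<cdots> a\<^bsub>T-1\<^esub>)\<close>. Uniqueness holds because the
  elliptic set is infinite.
\<close>

hide_const (open) module.smult

section \<open>Solutions of the three-term recursion as polynomials in the spectral
  parameter\<close>

text \<open>Polynomials rather than values, so that degrees and leading coefficients can be read
  off; \<open>x\<close> and \<open>y\<close> are the values at the sites 0 and 1, and
  \<open>1, 0\<close> and \<open>0, 1\<close> give the fundamental system.\<close>

fun sol_poly :: "(nat \<Rightarrow> real) \<Rightarrow> complex \<Rightarrow> complex \<Rightarrow> nat \<Rightarrow> complex poly" where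
  "sol_poly a x y 0 = [:x:]"
| "sol_poly a x y (Suc 0) = [:y:]"
| "sol_poly a x y (Suc (Suc n)) = smult (1 / complex_of_real (a (Suc n)))
     ([:0, 1:] * sol_poly a x y (Suc n) - smult (complex_of_real (a n)) (sol_poly a x y n))"

definition sol :: "(nat \<Rightarrow> real) \<Rightarrow> complex \<Rightarrow> complex \<Rightarrow> complex \<Rightarrow> nat \<Rightarrow> complex" where
  "sol a z x y n = poly (sol_poly a x y n) z"

lemma sol_0 [simp]: "sol a z x y 0 = x"
  by (simp add: sol_def)

lemma sol_1 [simp]: "sol a z x y (Suc 0) = y"
  by (simp add: sol_def)

lemma sol_Suc_Suc:
  "sol a z x y (Suc (Suc n)) =
    (z * sol a z x y (Suc n) - complex_of_real (a n) * sol a z x y n) / complex_of_real (a (Suc n))"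
  by (simp add: sol_def)

lemma degree_sol_poly: "degree (sol_poly a x y (Suc n)) \<le> n"
proof (induction n rule: less_induct)
  case (less n)
  show ?case
  proof (cases n)
    case (Suc m)
    have "degree ([:0, 1:] * sol_poly a x y (Suc m)) \<le> Suc m"
      using less.IH[of m] Suc by (intro order.trans[OF degree_mult_le]) simp
    moreover have "degree (sol_poly a x y m) \<le> Suc m"
      using less.IH[of "m - 1"] Suc by (cases m) (auto intro: le_SucI)
    ultimately show ?thesis
      using Suc by (auto intro!: order.trans[OF degree_smult_le] degree_diff_le)
  qed simp
qed

text \<open>Each step contributes one factor \<open>1 / a j\<close> to the top coefficient; the
  older term of the recursion has too small a degree to interfere, so \<open>x\<close> never
  enters.\<close>

lemma coeff_sol_poly: "coeff (sol_poly a x y (Suc n)) n = y / complex_of_real (\<Prod>j=1..n. a j)"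
proof (induction n)
  case (Suc n)
  have "coeff (sol_poly a x y n) (Suc n) = 0"
    using degree_sol_poly[of a x y "n - 1"] by (cases n) (auto intro: coeff_eq_0)
  with Suc show ?case
    by (simp add: field_simps)
qed simp

lemma sol_linear: "sol a z x y n = x * sol a z 1 0 n + y * sol a z 0 1 n"
proof (induction n rule: less_induct)
  case (less n)
  consider "n = 0" | "n = Suc 0" | m where "n = Suc (Suc m)"
    by (metis old.nat.exhaust)
  then show ?case
  proof cases
    case 3
    then show ?thesis
      using less.IH[of m] less.IH[of "Suc m"]
      by (simp add: sol_Suc_Suc diff_divide_distrib add_divide_distrib algebra_simps)
  qed auto
qed

text \<open>Dropping the first site makes the values at the sites 1 and 2 the new initial
  data.\<close>

lemma sol_shift:
  "sol a z x y (Suc n) =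
    sol (\<lambda>k. a (Suc k)) z y ((z * y - complex_of_real (a 0) * x) / complex_of_real (a 1)) n"
proof (induction n rule: less_induct)
  case (less n)
  consider "n = 0" | "n = Suc 0" | m where "n = Suc (Suc m)"
    by (metis old.nat.exhaust)
  then show ?case
  proof cases
    case 3
    then show ?thesis
      using less.IH[of m] less.IH[of "Suc m"] by (simp add: sol_Suc_Suc)
  qed (auto simp: sol_Suc_Suc)
qed

lemma cnj_sol:
  assumes "z \<in> \<real>"
  shows "cnj (sol a z x y n) = sol a z (cnj x) (cnj y) n"
proof (induction n rule: less_induct)
  case (less n)
  consider "n = 0" | "n = Suc 0" | m where "n = Suc (Suc m)"
    by (metis old.nat.exhaust)
  then show ?case
  proof cases
    case 3
    have "cnj z = z"
      using assms by (simp add: Reals_cnj_iff)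
    then show ?thesis
      using 3 less.IH[of m] less.IH[of "Suc m"] by (simp add: sol_Suc_Suc)
  qed auto
qed

lemma sol_real: "z \<in> \<real> \<Longrightarrow> x \<in> \<real> \<Longrightarrow> y \<in> \<real> \<Longrightarrow> sol a z x y n \<in> \<real>"
  by (simp add: Reals_cnj_iff cnj_sol)

text \<open>The recursion preserves the Wronskian weighted by \<open>a n\<close>. Over a full period
  this becomes determinant one.\<close>

lemma wronskian:
  assumes "\<And>n. a n \<noteq> 0"
  shows "complex_of_real (a n) *
    (sol a z 1 0 n * sol a z 0 1 (Suc n) - sol a z 1 0 (Suc n) * sol a z 0 1 n) =
    complex_of_real (a 0)"
proof (induction n)
  case (Suc n)
  show ?case
    unfolding Suc[symmetric] sol_Suc_Suc using assms[of "Suc n"]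
    by (simp add: field_simps)
qed simp

lemma phi_eq_sol:
  "phi a T z \<mu> n = sol a z 1 ((\<mu> - monodromy a T z $$ (0, 0)) / monodromy a T z $$ (0, 1)) n"
  by (induction a T z \<mu> n rule: phi.induct) (simp_all add: sol_Suc_Suc)

section \<open>Transfer matrices and eigenvalues of two-by-two matrices\<close>

lemma transfer_mat_carrier: "transfer_mat a j z \<in> carrier_mat 2 2"
  by (auto simp: transfer_mat_def mat_of_rows_list_def)

lemma transfer_prod_carrier: "transfer_prod a n z \<in> carrier_mat 2 2"
  by (induction n) (auto intro: mult_carrier_mat transfer_mat_carrier)

lemma index_mult_mat_2:
  assumes "A \<in> carrier_mat 2 2" "B \<in> carrier_mat 2 2" "i < 2" "j < 2"
  shows "(A * B) $$ (i, j) = A $$ (i, 0) * B $$ (0, j) + A $$ (i, 1) * B $$ (1, j)"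
  using assms by (auto simp: scalar_prod_def numeral_2_eq_2)

text \<open>A transfer matrix advances a pair of neighbouring values by one site, so the columns of
  the product are the two fundamental solutions at the sites \<open>n\<close> and
  \<open>n + 1\<close>.\<close>

lemma transfer_prod_index:
  "transfer_prod a n z $$ (0, 0) = sol a z 1 0 n \<and>
   transfer_prod a n z $$ (0, 1) = sol a z 0 1 n \<and>
   transfer_prod a n z $$ (1, 0) = sol a z 1 0 (Suc n) \<and>
   transfer_prod a n z $$ (1, 1) = sol a z 0 1 (Suc n)"
proof (induction n)
  case (Suc n)
  have "transfer_mat a (Suc n) z $$ (0, 0) = 0" "transfer_mat a (Suc n) z $$ (0, 1) = 1"
    "transfer_mat a (Suc n) z $$ (1, 0) = - complex_of_real (a n / a (Suc n))"
    "transfer_mat a (Suc n) z $$ (1, 1) = z / complex_of_real (a (Suc n))"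
    by (auto simp: transfer_mat_def mat_of_rows_list_def)
  then show ?case
    using Suc by (simp add: index_mult_mat_2[OF transfer_mat_carrier transfer_prod_carrier]
        sol_Suc_Suc diff_divide_distrib del: One_nat_def)
qed simp

lemma monodromy_carrier: "monodromy a T z \<in> carrier_mat 2 2"
  by (simp add: monodromy_def transfer_prod_carrier)

lemma monodromy_index:
  "monodromy a T z $$ (0, 0) = sol a z 1 0 T"
  "monodromy a T z $$ (0, 1) = sol a z 0 1 T"
  "monodromy a T z $$ (1, 0) = sol a z 1 0 (Suc T)"
  "monodromy a T z $$ (1, 1) = sol a z 0 1 (Suc T)"
  unfolding monodromy_def by (simp_all only: transfer_prod_index)

lemma eigenvalue_2E:
  fixes A :: "complex mat"
  assumes A: "A \<in> carrier_mat 2 2" and ev: "eigenvalue A k"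
  obtains x y where "x \<noteq> 0 \<or> y \<noteq> 0"
    "A $$ (0, 0) * x + A $$ (0, 1) * y = k * x" "A $$ (1, 0) * x + A $$ (1, 1) * y = k * y"
proof -
  obtain v where v: "v \<in> carrier_vec 2" "v \<noteq> 0\<^sub>v 2" "A *\<^sub>v v = k \<cdot>\<^sub>v v"
    using A ev by (auto simp: eigenvalue_def eigenvector_def)
  have "v $ 0 \<noteq> 0 \<or> v $ 1 \<noteq> 0"
  proof (rule ccontr)
    assume "\<not> ?thesis"
    then have "v = 0\<^sub>v 2"
      using v(1) by (intro eq_vecI) (auto simp: less_2_cases_iff)
    then show False
      using v(2) by simp
  qed
  moreover have "(A *\<^sub>v v) $ i = (k \<cdot>\<^sub>v v) $ i" for i
    using v(3) by simp
  from this[of 0] this[of 1]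
  have "A $$ (0, 0) * v $ 0 + A $$ (0, 1) * v $ 1 = k * v $ 0"
    "A $$ (1, 0) * v $ 0 + A $$ (1, 1) * v $ 1 = k * v $ 1"
    using A v(1) by (simp_all add: scalar_prod_def numeral_2_eq_2)
  ultimately show thesis
    by (rule that)
qed

lemma eigenvalue_2I:
  fixes A :: "complex mat"
  assumes A: "A \<in> carrier_mat 2 2" and xy: "x \<noteq> 0 \<or> y \<noteq> 0"
    "A $$ (0, 0) * x + A $$ (0, 1) * y = k * x" "A $$ (1, 0) * x + A $$ (1, 1) * y = k * y"
  shows "eigenvalue A k"
proof -
  define v where "v = Matrix.vec 2 (\<lambda>i. if i = 0 then x else y)"
  have v: "v \<in> carrier_vec 2" "v $ 0 = x" "v $ 1 = y"
    by (simp_all add: v_def)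
  have "v \<noteq> 0\<^sub>v 2"
  proof
    assume "v = 0\<^sub>v 2"
    then show False
      using v(2,3) xy(1) by simp
  qed
  moreover have "A *\<^sub>v v = k \<cdot>\<^sub>v v"
  proof (rule eq_vecI)
    fix i assume "i < dim_vec (k \<cdot>\<^sub>v v)"
    then have "i = 0 \<or> i = 1"
      using v(1) by auto
    then show "(A *\<^sub>v v) $ i = (k \<cdot>\<^sub>v v) $ i"
      using A v xy(2,3) by (elim disjE) (simp_all add: scalar_prod_def numeral_2_eq_2)
  qed (use A v(1) in simp)
  ultimately have "eigenvector A v k"
    using A v(1) by (simp add: eigenvector_def)
  then show ?thesis
    unfolding eigenvalue_def by (rule exI)
qed

lemma eigenvalue_2_char:
  fixes A :: "complex mat"
  assumes A: "A \<in> carrier_mat 2 2"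
  shows "eigenvalue A k \<longleftrightarrow>
    (k - A $$ (0, 0)) * (k - A $$ (1, 1)) = A $$ (0, 1) * A $$ (1, 0)" (is "?l \<longleftrightarrow> ?r")
proof
  assume ?l
  then obtain x y where xy: "x \<noteq> 0 \<or> y \<noteq> 0"
    "A $$ (0, 0) * x + A $$ (0, 1) * y = k * x" "A $$ (1, 0) * x + A $$ (1, 1) * y = k * y"
    by (rule eigenvalue_2E[OF A])
  have alg: "((k - p) * (k - s) - q * r) * x = 0 \<and> ((k - p) * (k - s) - q * r) * y = 0"
    if "p * x + q * y = k * x" "r * x + s * y = k * y" for p q r s :: complex
  proof -
    \<comment> \<open>The adjugate of \<open>k - A\<close> applied to the eigenvector
      equations.\<close>
    have "((k - p) * (k - s) - q * r) * x = (k - s) * (k * x - (p * x + q * y)) + q * (k * y - (r * x + s * y))"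
      "((k - p) * (k - s) - q * r) * y = r * (k * x - (p * x + q * y)) + (k - p) * (k * y - (r * x + s * y))"
      by (simp_all add: algebra_simps)
    then show ?thesis
      by (simp add: that)
  qed
  then show ?r
    using alg[OF xy(2,3)] xy(1) by (metis mult_eq_0_iff right_minus_eq)
next
  assume r: ?r
  \<comment> \<open>The first vector is annihilated by the first row of \<open>A - k\<close>, the
    second by the second row; the characteristic equation handles the other row. If both vectors
    vanish, the first unit vector serves.\<close>
  consider "A $$ (0, 1) \<noteq> 0 \<or> k - A $$ (0, 0) \<noteq> 0" | "k - A $$ (1, 1) \<noteq> 0 \<or> A $$ (1, 0) \<noteq> 0"
    | "A $$ (0, 1) = 0" "k = A $$ (0, 0)" "A $$ (1, 0) = 0"
    by (metis right_minus_eq)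
  then show ?l
  proof cases
    case 1
    show ?thesis
      by (rule eigenvalue_2I[OF A 1]) (use r in \<open>simp_all add: algebra_simps\<close>)
  next
    case 2
    show ?thesis
      by (rule eigenvalue_2I[OF A 2]) (use r in \<open>simp_all add: algebra_simps\<close>)
  next
    case 3
    show ?thesis
      by (rule eigenvalue_2I[OF A, of 1 0]) (simp_all only: 3, simp_all)
  qed
qed

section \<open>Rational functions: evaluation, order, uniqueness, growth at infinity\<close>

text \<open>Links an arbitrary, possibly unreduced, representation to the one in lowest terms; the
  divisibility follows from coprimality.\<close>

lemma ratfun_cross:
  assumes "D \<noteq> 0"
  shows "N * ratfun_denom (Fract N D) = D * ratfun_num (Fract N D)"
    and "ratfun_denom (Fract N D) dvd D"
proof -
  let ?R = "Fract N D"
  have nz: "ratfun_denom ?R \<noteq> 0" and cop: "coprime (ratfun_num ?R) (ratfun_denom ?R)"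
    by (simp_all add: ratfun_denom_def ratfun_num_def coprime_quot_of_fract)
  have "?R = Fract (ratfun_num ?R) (ratfun_denom ?R)"
    by (simp add: ratfun_denom_def ratfun_num_def Fract_quot_of_fract)
  then show eq: "N * ratfun_denom ?R = D * ratfun_num ?R"
    using assms nz by (metis eq_fract(1) mult.commute)
  then have "ratfun_denom ?R dvd D * ratfun_num ?R"
    by (metis dvd_triv_right)
  then show "ratfun_denom ?R dvd D"
    using cop by (simp add: coprime_commute coprime_dvd_mult_left_iff)
qed

lemma ratfun_denom_nonzero [simp]: "ratfun_denom R \<noteq> 0"
  by (simp add: ratfun_denom_def)

text \<open>The reduced denominator divides \<open>D\<close>, so where \<open>D\<close> does not
  vanish the value is not the default one for poles.\<close>

lemma ratfun_eval_Fract: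
  assumes "poly D z \<noteq> 0"
  shows "poly (ratfun_denom (Fract N D)) z \<noteq> 0"
    and "ratfun_eval (Fract N D) z = poly N z / poly D z"
proof -
  have D: "D \<noteq> 0"
    using assms by auto
  show nz: "poly (ratfun_denom (Fract N D)) z \<noteq> 0"
    using ratfun_cross(2)[OF D, of N] assms by (metis dvdE mult_zero_left poly_mult)
  have "poly N z * poly (ratfun_denom (Fract N D)) z = poly D z * poly (ratfun_num (Fract N D)) z"
    using ratfun_cross(1)[OF D, of N] by (metis poly_mult)
  then show "ratfun_eval (Fract N D) z = poly N z / poly D z"
    using nz assms by (simp add: ratfun_eval_def field_simps)
qed

lemma ratfun_order_Fract:
  assumes "N \<noteq> 0" "D \<noteq> 0"
  shows "ratfun_order (Fract N D) = int (degree N) - int (degree D)"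
proof -
  have cross: "N * ratfun_denom (Fract N D) = D * ratfun_num (Fract N D)"
    using ratfun_cross(1)[OF assms(2)] .
  with assms have "ratfun_num (Fract N D) \<noteq> 0"
    by (metis mult_eq_0_iff ratfun_denom_nonzero)
  then have "degree N + degree (ratfun_denom (Fract N D)) =
      degree D + degree (ratfun_num (Fract N D))"
    using assms arg_cong[OF cross, of degree] by (simp add: degree_mult_eq)
  then show ?thesis
    by (simp add: ratfun_order_def)
qed

text \<open>The cross difference of the two fractions is a polynomial with infinitely many
  zeros.\<close>

lemma ratfun_eqI:
  assumes "infinite S"
    and "\<And>z. z \<in> S \<Longrightarrow> poly (ratfun_denom R) z \<noteq> 0 \<and> poly (ratfun_denom R') z \<noteq> 0 \<and>
      ratfun_eval R z = ratfun_eval R' z"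
  shows "R = R'"
proof -
  let ?p = "ratfun_num R * ratfun_denom R' - ratfun_num R' * ratfun_denom R"
  have "S \<subseteq> {z. poly ?p z = 0}"
  proof
    fix z assume "z \<in> S"
    from assms(2)[OF this] show "z \<in> {z. poly ?p z = 0}"
      by (auto simp: ratfun_eval_def divide_simps mult.commute)
  qed
  then have "?p = 0"
    using assms(1) finite_subset poly_roots_finite by blast
  then have "Fract (ratfun_num R) (ratfun_denom R) = Fract (ratfun_num R') (ratfun_denom R')"
    by (simp add: eq_fract)
  then show ?thesis
    by (simp add: ratfun_num_def ratfun_denom_def Fract_quot_of_fract)
qed

text \<open>Induction splits off the constant term, which dies after division by a positive power of
  \<open>z\<close>. The exponent may exceed the degree, and the limit is then 0.\<close>

lemma poly_div_power_at_infinity: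
  fixes p :: "complex poly"
  shows "degree p \<le> n \<Longrightarrow> ((\<lambda>z. poly p z / z ^ n) \<longlongrightarrow> coeff p n) at_infinity"
proof (induction p arbitrary: n)
  case (pCons c p)
  show ?case
  proof (cases n)
    case 0
    with pCons.prems have "p = 0"
      by (simp split: if_splits)
    then show ?thesis
      using 0 by simp
  next
    case (Suc m)
    have "((\<lambda>z. c * (inverse z) ^ n + poly p z / z ^ m) \<longlongrightarrow> c * 0 ^ n + coeff p m) at_infinity"
      using pCons.prems Suc
      by (intro tendsto_intros tendsto_inverse_0 pCons.IH) (auto split: if_splits)
    moreover have "\<forall>\<^sub>F z in at_infinity.
        c * (inverse z) ^ n + poly p z / z ^ m = poly (pCons c p) z / z ^ n"
      using eventually_not_equal_at_infinity[of 0]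
      by eventually_elim (simp add: Suc add_divide_distrib inverse_eq_divide power_divide)
    ultimately have "((\<lambda>z. poly (pCons c p) z / z ^ n) \<longlongrightarrow> c * 0 ^ n + coeff p m) at_infinity"
      by (rule Lim_transform_eventually)
    then show ?thesis
      using Suc by simp
  qed
qed simp

lemma ratfun_asymp:
  assumes "degree N \<le> Suc n" "degree D \<le> n" "coeff D n \<noteq> 0" "coeff N (Suc n) = c * coeff D n" "c \<noteq> 0"
  shows "ratfun_eval (Fract N D) \<sim>[at_infinity] (\<lambda>z. c * z)"
proof (rule asymp_equivI')
  have D: "D \<noteq> 0"
    using assms(3) by auto
  have "((\<lambda>z. (poly N z / z ^ Suc n) / (poly D z / z ^ n) / c) \<longlongrightarrow> coeff N (Suc n) / coeff D n / c)
      at_infinity"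
    using assms by (intro tendsto_intros poly_div_power_at_infinity) auto
  \<comment> \<open>The finitely many zeros of \<open>D\<close> lie in a disc; outside it the
    fraction evaluates to the plain quotient.\<close>
  moreover have "\<forall>\<^sub>F z in at_infinity. poly D z \<noteq> 0"
  proof -
    have "bounded {z. poly D z = 0}"
      using D by (simp add: poly_roots_finite finite_imp_bounded)
    then obtain b where b: "\<And>z. poly D z = 0 \<Longrightarrow> norm z \<le> b"
      by (auto simp: bounded_iff)
    show ?thesis
      unfolding eventually_at_infinity using b
      by (intro exI[of _ "b + 1"]) force
  qed
  then have "\<forall>\<^sub>F z in at_infinity.
      (poly N z / z ^ Suc n) / (poly D z / z ^ n) / c = ratfun_eval (Fract N D) z / (c * z)"
    using eventually_not_equal_at_infinity[of 0]
    by eventually_elim (simp add: ratfun_eval_Fract)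
  ultimately have "((\<lambda>z. ratfun_eval (Fract N D) z / (c * z)) \<longlongrightarrow> coeff N (Suc n) / coeff D n / c)
      at_infinity"
    by (rule Lim_transform_eventually)
  then show "((\<lambda>z. ratfun_eval (Fract N D) z / (c * z)) \<longlongrightarrow> 1) at_infinity"
    using assms by simp
qed

section \<open>The monodromy matrix of periodic weights and its elliptic set\<close>

text \<open>The assumptions are invariant under a shift of the weights, so that the results can be
  instantiated at every starting site.\<close>

locale periodic_weights =
  fixes a :: "nat \<Rightarrow> real" and T :: nat
  assumes T_pos: "T \<ge> 1"
    and a_pos: "a j > 0"
    and periodic: "a (n + T) = a n"
begin

lemma a_nonzero [simp]: "a j \<noteq> 0"
  using a_pos[of j] by simp

lemma periodic_0 [simp]: "a T = a 0"
  using periodic[of 0] by simp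

lemma det_monodromy:
  "sol a z 1 0 T * sol a z 0 1 (Suc T) - sol a z 1 0 (Suc T) * sol a z 0 1 T = 1"
  using wronskian[of a T z] by simp

lemma eigenvalue_monodromy:
  "eigenvalue (monodromy a T z) \<mu> \<longleftrightarrow> \<mu>\<^sup>2 - (sol a z 1 0 T + sol a z 0 1 (Suc T)) * \<mu> + 1 = 0"
proof -
  have "eigenvalue (monodromy a T z) \<mu> \<longleftrightarrow>
    (\<mu> - sol a z 1 0 T) * (\<mu> - sol a z 0 1 (Suc T)) = sol a z 0 1 T * sol a z 1 0 (Suc T)"
    unfolding eigenvalue_2_char[OF monodromy_carrier] monodromy_index ..
  also have "\<dots> \<longleftrightarrow> \<mu>\<^sup>2 - (sol a z 1 0 T + sol a z 0 1 (Suc T)) * \<mu> + 1 = 0"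
  proof -
    have "(\<mu> - p) * (\<mu> - s) = q * r \<longleftrightarrow> \<mu>\<^sup>2 - (p + s) * \<mu> + 1 = 0"
      if "p * s - r * q = 1" for p q r s :: complex
    proof -
      have "(\<mu> - p) * (\<mu> - s) - q * r = \<mu>\<^sup>2 - (p + s) * \<mu> + (p * s - r * q)"
        by (simp add: algebra_simps power2_eq_square)
      then show ?thesis
        unfolding that by (metis right_minus_eq)
    qed
    from this[OF det_monodromy] show ?thesis .
  qed
  finally show ?thesis .
qed

text \<open>
  Pairing the recursion with the conjugate of a quasi-periodic solution and summing over one
  period expresses \<open>z\<close> times a positive number as \<open>w + cnj w\<close>.
\<close>
lemma eigenvalue_norm_1_imp_real:
  assumes "eigenvalue (monodromy a T z) \<mu>" "cmod \<mu> = 1"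
  shows "z \<in> \<real>"
proof -
  obtain x y where xy: "x \<noteq> 0 \<or> y \<noteq> 0"
    "sol a z 1 0 T * x + sol a z 0 1 T * y = \<mu> * x"
    "sol a z 1 0 (Suc T) * x + sol a z 0 1 (Suc T) * y = \<mu> * y"
    using eigenvalue_2E[OF monodromy_carrier assms(1)] unfolding monodromy_index .
  define u where "u = sol a z x y"
  have uT: "u T = \<mu> * x" "u (Suc T) = \<mu> * y" and u0: "u 0 = x" "u (Suc 0) = y"
    using xy(2,3) sol_linear[of a z x y]
    by (simp_all add: u_def mult.commute)
  define t where "t = (\<lambda>s. complex_of_real (a s) * u (Suc s) * cnj (u s))"
  have rec: "z * (u (Suc s) * cnj (u (Suc s))) = t (Suc s) + cnj (t s)" for s
    unfolding t_def u_def sol_Suc_Suc by (simp add: field_simps)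
  have "\<mu> * cnj \<mu> = 1"
    using assms(2) complex_norm_square[of \<mu>] by simp
  \<comment> \<open>The Floquet factor cancels against its conjugate, so \<open>t\<close> closes up
    over one period.\<close>
  then have "t T = t 0"
    by (simp add: t_def uT u0 algebra_simps)
  then have "(\<Sum>s<T. t (Suc s)) = (\<Sum>s<T. t s)"
    using sum.lessThan_Suc_shift[of t T] by simp
  then have "z * (\<Sum>s<T. u (Suc s) * cnj (u (Suc s))) = (\<Sum>s<T. t s) + cnj (\<Sum>s<T. t s)"
    by (simp add: sum_distrib_left rec sum.distrib)
  moreover have "(\<Sum>s<T. u (Suc s) * cnj (u (Suc s))) =
      complex_of_real (\<Sum>s<T. (cmod (u (Suc s)))\<^sup>2)"
    by (simp add: complex_norm_square del: of_real_power)
  ultimately have *: "z * complex_of_real (\<Sum>s<T. (cmod (u (Suc s)))\<^sup>2) = 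
      complex_of_real (2 * Re (\<Sum>s<T. t s))"
    by (metis complex_add_cnj)
  have "(\<Sum>s<T. (cmod (u (Suc s)))\<^sup>2) \<noteq> 0"
  proof
    assume "(\<Sum>s<T. (cmod (u (Suc s)))\<^sup>2) = 0"
    then have "\<forall>s<T. u (Suc s) = 0"
      by (subst (asm) sum_nonneg_eq_0_iff) auto
    \<comment> \<open>The sites 1 and \<open>T\<close> carry \<open>y\<close> and
      \<open>\<mu> * x\<close>, so both components of the eigenvector would vanish.\<close>
    from this[rule_format, of 0] this[rule_format, of "T - 1"] have "u (Suc 0) = 0" "u T = 0"
      using T_pos by auto
    then show False
      using uT u0 xy(1) assms(2) by auto
  qed
  then have "z = complex_of_real (2 * Re (\<Sum>s<T. t s) / (\<Sum>s<T. (cmod (u (Suc s)))\<^sup>2))"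
    using * by (simp add: field_simps del: of_real_sum)
  then show ?thesis
    by (metis Reals_of_real)
qed

text \<open>The two unimodular eigenvalues exhaust the roots of the characteristic equation, and for
  a unimodular root the conjugate is the inverse, which turns that equation into the trace
  formula.\<close>

lemma elliptic_eigenvalue:
  assumes "z \<in> sigma_ell a T" "eigenvalue (monodromy a T z) \<mu>"
  shows "z \<in> \<real>" "cnj \<mu> * \<mu> = 1" "\<mu> + cnj \<mu> = sol a z 1 0 T + sol a z 0 1 (Suc T)"
    "sol a z 0 1 T \<noteq> 0"
proof -
  let ?t = "sol a z 1 0 T + sol a z 0 1 (Suc T)"
  obtain \<mu>1 \<mu>2 where m: "\<mu>1 \<noteq> \<mu>2" "cmod \<mu>1 = 1" "cmod \<mu>2 = 1"
    "eigenvalue (monodromy a T z) \<mu>1" "eigenvalue (monodromy a T z) \<mu>2"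
    using assms(1) unfolding sigma_ell_def by blast
  show z: "z \<in> \<real>"
    using eigenvalue_norm_1_imp_real m by blast
  have e: "\<mu>1\<^sup>2 - ?t * \<mu>1 + 1 = 0" "\<mu>2\<^sup>2 - ?t * \<mu>2 + 1 = 0" "\<mu>\<^sup>2 - ?t * \<mu> + 1 = 0"
    using m(4,5) assms(2) eigenvalue_monodromy by auto
  have "(\<mu>1 - \<mu>2) * (\<mu>1 + \<mu>2 - ?t) = (\<mu>1\<^sup>2 - ?t * \<mu>1 + 1) - (\<mu>2\<^sup>2 - ?t * \<mu>2 + 1)"
    by (simp add: algebra_simps power2_eq_square)
  then have "(\<mu>1 - \<mu>2) * (\<mu>1 + \<mu>2 - ?t) = 0"
    using e by simp
  then have t: "\<mu>1 + \<mu>2 = ?t"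
    using m(1) by auto
  have alg: "(\<mu> - \<mu>1) * (\<mu> - \<mu>2) = 0 \<and> \<mu>1 * \<mu>2 = 1" if "\<mu>1 + \<mu>2 = t"
    "\<mu>1\<^sup>2 - t * \<mu>1 + 1 = 0" "\<mu>\<^sup>2 - t * \<mu> + 1 = 0" for t
  proof -
    have prod: "\<mu>1 * \<mu>2 = 1"
      using that(2) unfolding that(1)[symmetric] by (simp add: algebra_simps power2_eq_square)
    have "(\<mu> - \<mu>1) * (\<mu> - \<mu>2) = \<mu>\<^sup>2 - (\<mu>1 + \<mu>2) * \<mu> + \<mu>1 * \<mu>2"
      by (simp add: algebra_simps power2_eq_square)
    also have "\<dots> = 0"
      unfolding that(1) prod by (rule that(3))
    finally show ?thesis
      using prod by (rule conjI)
  qed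
  have "(\<mu> - \<mu>1) * (\<mu> - \<mu>2) = 0" and prod: "\<mu>1 * \<mu>2 = 1"
    using alg[OF t e(1,3)] by simp_all
  then have "\<mu> = \<mu>1 \<or> \<mu> = \<mu>2"
    by auto
  then have "cmod \<mu> = 1"
    using m by auto
  then show c: "cnj \<mu> * \<mu> = 1"
    using complex_norm_square[of \<mu>] by (simp add: mult.commute)
  then have "\<mu> \<noteq> 0"
    by auto
  have "\<mu> * (\<mu> + cnj \<mu> - ?t) = (\<mu>\<^sup>2 - ?t * \<mu> + 1) + (cnj \<mu> * \<mu> - 1)"
    by (simp add: algebra_simps power2_eq_square)
  then have "\<mu> * (\<mu> + cnj \<mu> - ?t) = 0"
    unfolding c e(3) by simp
  then show "\<mu> + cnj \<mu> = ?t"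
    using \<open>\<mu> \<noteq> 0\<close> by auto
  show "sol a z 0 1 T \<noteq> 0"
  \<comment> \<open>If \<open>m_12\<close> vanished, the eigenvalues would be the diagonal entries,
    which are real. A real number of modulus one is its own inverse, so \<open>\<mu>1\<close> and
    \<open>\<mu>2\<close> would coincide.\<close>
  proof
    assume "sol a z 0 1 T = 0"
    then have "sol a z 1 0 T * sol a z 0 1 (Suc T) = 1"
      using det_monodromy[of z] by simp
    then have "(\<mu>1 - sol a z 1 0 T) * (\<mu>1 - sol a z 0 1 (Suc T)) = 0"
      using e(1) by (simp add: algebra_simps power2_eq_square)
    then have "\<mu>1 \<in> \<real>"
      using sol_real[OF z] by auto
    then have "cnj \<mu>1 = \<mu>1"
      by (simp add: Reals_cnj_iff)
    then have "\<mu>1 * \<mu>1 = 1"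
      using m(2) complex_norm_square[of \<mu>1] by simp
    then show False
      using prod m(1) by (metis mult_cancel_left mult_zero_left zero_neq_one)
  qed
qed

definition trace_poly :: "complex poly" where
  "trace_poly = sol_poly a 1 0 T + sol_poly a 0 1 (Suc T)"

text \<open>Only \<open>m_22\<close> reaches degree \<open>T\<close>, so its nonzero leading
  coefficient survives in the trace.\<close>

lemma trace_poly_nonconstant: "degree trace_poly \<noteq> 0"
proof -
  have "degree (sol_poly a 1 0 T) < T"
    using degree_sol_poly[of a 1 0 "T - 1"] T_pos by simp
  then have "coeff trace_poly T \<noteq> 0"
    by (simp add: trace_poly_def coeff_sol_poly coeff_eq_0)
  then show ?thesis
    using le_degree T_pos by fastforce
qed

text \<open>
  By the fundamental theorem of algebra the trace takes every value \<open>2 * cos \<theta>\<close> somewhere in the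
  complex plane; a point where it does is elliptic unless \<open>sin \<theta> = 0\<close>.
\<close>
lemma infinite_sigma_ell: "infinite (sigma_ell a T)"
proof -
  have "complex_of_real c \<in> poly trace_poly ` sigma_ell a T" if c: "c \<in> {-2<..<2}" for c
  proof -
    have "degree (trace_poly - [:complex_of_real c:]) \<noteq> 0"
      unfolding diff_conv_add_uminus
      using trace_poly_nonconstant degree_add_eq_left[of "- [:complex_of_real c:]" trace_poly] by simp
    then have "\<not> constant (poly (trace_poly - [:complex_of_real c:]))"
      by (simp add: constant_degree)
    from fundamental_theorem_of_algebra[OF this]
    obtain z where z: "poly trace_poly z = complex_of_real c"
      by auto
    \<comment> \<open>With \<open>c = 2 * cos \<theta>\<close> this is the absolute value of
      \<open>sin \<theta>\<close>; it is the imaginary part of one of the two conjugate unimodular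
      eigenvalues.\<close>
    define r where "r = sqrt (1 - (c / 2)\<^sup>2)"
    have "(c / 2)\<^sup>2 < 1"
      using c by (simp add: abs_square_less_1 abs_less_iff)
    then have r: "r > 0" "r\<^sup>2 = 1 - (c / 2)\<^sup>2"
      by (simp_all add: r_def)
    let ?m = "Complex (c / 2) r" and ?n = "Complex (c / 2) (- r)"
    have tr: "sol a z 1 0 T + sol a z 0 1 (Suc T) = complex_of_real c"
      using z by (simp add: trace_poly_def sol_def del: sol_poly.simps)
    have "cmod ?m = 1" "cmod ?n = 1"
      using r(2) by (simp_all add: cmod_def)
    moreover have "eigenvalue (monodromy a T z) ?m" "eigenvalue (monodromy a T z) ?n"
      using r(2) unfolding eigenvalue_monodromy tr
      by (simp_all add: complex_eq_iff power2_eq_square field_simps)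
    moreover have "?m \<noteq> ?n"
      using r(1) by simp
    ultimately have "z \<in> sigma_ell a T"
      unfolding sigma_ell_def by blast
    then show ?thesis
      using z by (metis image_eqI)
  qed
  then have "complex_of_real ` {-2<..<2} \<subseteq> poly trace_poly ` sigma_ell a T"
    by auto
  moreover have "infinite (complex_of_real ` {-2<..<2})"
    by (subst finite_image_iff) (auto simp: inj_on_def)
  ultimately show ?thesis
    using finite_subset finite_imageI by metis
qed

section \<open>Shifted monodromy matrices and products of Floquet solutions\<close>

lemma periodic_weights_shift: "periodic_weights (\<lambda>k. a (k + s)) T"
proof
  show "a (n + T + s) = a (n + s)" for n
    using periodic[of "n + s"] by (simp add: ac_simps)
qed (use T_pos a_pos in auto)

text \<open>This is the conjugation of the monodromy matrix by the first transfer matrix.\<close>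
lemma monodromy_shift:
  defines "b \<equiv> \<lambda>k. a (Suc k)"
  shows "complex_of_real (a 0) * sol b z 0 1 T = - complex_of_real (a 1) * sol a z 1 0 (Suc T)"
    and "complex_of_real (a 0) * sol b z 1 0 T =
      complex_of_real (a 0) * sol a z 0 1 (Suc T) + z * sol a z 1 0 (Suc T)"
    and "complex_of_real (a 0) * sol b z 0 1 (Suc T) =
      complex_of_real (a 0) * sol a z 1 0 T - z * sol a z 1 0 (Suc T)"
    and "complex_of_real (a 0 * a 1) * sol b z 1 0 (Suc T) =
      z * (complex_of_real (a 0) * (sol a z 0 1 (Suc T) - sol a z 1 0 T) + z * sol a z 1 0 (Suc T))
      - complex_of_real ((a 0)\<^sup>2) * sol a z 0 1 T"
proof -
  \<comment> \<open>After the shift, the initial values \<open>1, 0\<close> become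
    \<open>0, - a 0 / a 1\<close>, and \<open>0, 1\<close> become \<open>1, z / a 1\<close>.\<close>
  have P: "sol a z 1 0 (Suc n) = - complex_of_real (a 0 / a 1) * sol b z 0 1 n" for n
    unfolding sol_shift[of a z 1 0 n] b_def[symmetric]
    by (subst sol_linear) simp
  have Q: "sol a z 0 1 (Suc n) = sol b z 1 0 n + z / complex_of_real (a 1) * sol b z 0 1 n" for n
    unfolding sol_shift[of a z 0 1 n] b_def[symmetric]
    by (subst sol_linear) simp
  have aT: "a (Suc T) = a 1"
    using periodic[of 1] by simp
  have nz: "complex_of_real (a 0) \<noteq> 0" "complex_of_real (a 1) \<noteq> 0"
    by simp_all
  \<comment> \<open>The second row of the shifted matrix reaches site \<open>T + 2\<close>;
    periodicity rewrites the weights in that recursion step as \<open>a 1\<close> and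
    \<open>a 0\<close>.\<close>
  have P2: "complex_of_real (a 1) * sol a z 1 0 (Suc (Suc T)) =
      z * sol a z 1 0 (Suc T) - complex_of_real (a 0) * sol a z 1 0 T"
   and Q2: "complex_of_real (a 1) * sol a z 0 1 (Suc (Suc T)) =
      z * sol a z 0 1 (Suc T) - complex_of_real (a 0) * sol a z 0 1 T"
    unfolding sol_Suc_Suc aT periodic_0 using nz by simp_all
  show 1: "complex_of_real (a 0) * sol b z 0 1 T = - complex_of_real (a 1) * sol a z 1 0 (Suc T)"
    unfolding P by simp
  show 2: "complex_of_real (a 0) * sol b z 1 0 T =
      complex_of_real (a 0) * sol a z 0 1 (Suc T) + z * sol a z 1 0 (Suc T)"
    unfolding P Q by (simp add: algebra_simps)
  have "complex_of_real (a 0) * sol b z 0 1 (Suc T) =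
      - complex_of_real (a 1) * sol a z 1 0 (Suc (Suc T))"
    unfolding P[of "Suc T"] by simp
  then show 3: "complex_of_real (a 0) * sol b z 0 1 (Suc T) =
      complex_of_real (a 0) * sol a z 1 0 T - z * sol a z 1 0 (Suc T)"
    using P2 by simp
  have Q3: "complex_of_real (a 1) * sol a z 0 1 (Suc (Suc T)) =
      complex_of_real (a 1) * sol b z 1 0 (Suc T) + z * sol b z 0 1 (Suc T)"
    unfolding Q[of "Suc T"] by (simp add: distrib_left)
  show "complex_of_real (a 0 * a 1) * sol b z 1 0 (Suc T) =
      z * (complex_of_real (a 0) * (sol a z 0 1 (Suc T) - sol a z 1 0 T) + z * sol a z 1 0 (Suc T))
      - complex_of_real ((a 0)\<^sup>2) * sol a z 0 1 T"
  proof -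
    have "A0 * A1 * p = z * (A0 * (s - t) + z * w) - A0\<^sup>2 * q"
      if "A0 * r = A0 * t - z * w" "A1 * x = z * s - A0 * q" "A1 * x = A1 * p + z * r"
      for A0 A1 p q r s t w x :: complex
    proof -
      have "A0 * A1 * p = A0 * (A1 * x) - z * (A0 * r)"
        unfolding that(3) by (simp add: algebra_simps)
      then show ?thesis
        unfolding that(1,2) by (simp add: algebra_simps power2_eq_square)
    qed
    from this[OF 3 Q2 Q3] show ?thesis
      unfolding of_real_mult of_real_power by simp
  qed
qed

text \<open>
  If \<open>u\<close> and \<open>v\<close> are the two Floquet solutions, their products at neighbouring sites are read off
  the monodromy matrix that starts at the site \<open>s\<close>. Its entries have degree at most \<open>T\<close> in \<open>z\<close>,
  whereas expanding the products in the fundamental solutions hides large cancellations.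
\<close>
lemma floquet_products:
  fixes z y y' :: complex and s :: nat
  defines "b \<equiv> \<lambda>s k. a (k + s)"
  defines "u \<equiv> sol a z 1 y" and "v \<equiv> sol a z 1 y'"
  assumes y: "sol a z 0 1 T * (y + y') = sol a z 0 1 (Suc T) - sol a z 1 0 T"
    "sol a z 0 1 T * (y * y') = - sol a z 1 0 (Suc T)"
  shows "complex_of_real (a s) * sol a z 0 1 T * (u s * v s) = complex_of_real (a 0) * sol (b s) z 0 1 T"
    "complex_of_real (a s) * sol a z 0 1 T * (u (Suc s) * v s + u s * v (Suc s)) =
      complex_of_real (a 0) * (sol (b s) z 0 1 (Suc T) - sol (b s) z 1 0 T)"
    "complex_of_real (a s) * sol a z 0 1 T * (u (Suc s) * v (Suc s)) =
      - complex_of_real (a 0) * sol (b s) z 1 0 (Suc T)"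
proof (induction s)
  case 0
  \<comment> \<open>At site 0 the assumptions on \<open>y\<close> and \<open>y'\<close> are Vieta's
    formulas for the slopes of the two eigenvectors.\<close>
  have "b 0 = a" "u 0 = 1" "v 0 = 1" "u (Suc 0) = y" "v (Suc 0) = y'"
    by (simp_all add: b_def u_def v_def)
  then show "complex_of_real (a 0) * sol a z 0 1 T * (u 0 * v 0) = complex_of_real (a 0) * sol (b 0) z 0 1 T"
    "complex_of_real (a 0) * sol a z 0 1 T * (u (Suc 0) * v 0 + u 0 * v (Suc 0)) =
      complex_of_real (a 0) * (sol (b 0) z 0 1 (Suc T) - sol (b 0) z 1 0 T)"
    "complex_of_real (a 0) * sol a z 0 1 T * (u (Suc 0) * v (Suc 0)) =
      - complex_of_real (a 0) * sol (b 0) z 1 0 (Suc T)"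
    by (simp_all add: mult.assoc y)
next
  case (Suc s)
  interpret b: periodic_weights "b s" T
    unfolding b_def by (rule periodic_weights_shift)
  have b: "(\<lambda>k. b s (Suc k)) = b (Suc s)" "b s 0 = a s" "b s 1 = a (Suc s)"
    by (simp_all add: b_def)
  note sh = b.monodromy_shift[of z, unfolded b of_real_mult of_real_power]
  have nz: "complex_of_real (a s) \<noteq> 0" "complex_of_real (a (Suc s)) \<noteq> 0"
    by simp_all
  have u: "complex_of_real (a (Suc s)) * u (Suc (Suc s)) = z * u (Suc s) - complex_of_real (a s) * u s"
    and v: "complex_of_real (a (Suc s)) * v (Suc (Suc s)) = z * v (Suc s) - complex_of_real (a s) * v s"
    unfolding u_def v_def sol_Suc_Suc using nz by simp_all
  \<comment> \<open>The shift formulas carry factors of weights, so each claim is proved after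
    multiplication by nonzero weights that are then cancelled. The three products must be treated
    together, as the recursion mixes them.\<close>
  have "complex_of_real (a s) * (complex_of_real (a (Suc s)) * sol a z 0 1 T * (u (Suc s) * v (Suc s))) =
      complex_of_real (a s) * (complex_of_real (a 0) * sol (b (Suc s)) z 0 1 T)"
  proof -
    have "A * (A' * D * w) = A * (A0 * m12')"
      if "A * D * w = - A0 * m21" "A * m12' = - A' * m21" for A A' A0 D w m12' m21 :: complex
    proof -
      have "A * (A' * D * w) = A' * (A * D * w)"
        by (simp add: algebra_simps)
      also have "\<dots> = A0 * (A * m12')"
        unfolding that by (simp add: algebra_simps)
      finally show ?thesis
        by (simp add: algebra_simps)
    qed
    from this[OF Suc(3) sh(1)] show ?thesis .
  qed
  then show "complex_of_real (a (Suc s)) * sol a z 0 1 T * (u (Suc s) * v (Suc s)) =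
      complex_of_real (a 0) * sol (b (Suc s)) z 0 1 T"
    using nz by (simp only: mult_cancel_left) simp
  have "complex_of_real (a s) * (complex_of_real (a (Suc s)) * sol a z 0 1 T *
      (u (Suc (Suc s)) * v (Suc s) + u (Suc s) * v (Suc (Suc s)))) =
      complex_of_real (a s) * (complex_of_real (a 0) *
        (sol (b (Suc s)) z 0 1 (Suc T) - sol (b (Suc s)) z 1 0 T))"
  proof -
    have "A * (A' * D * (u2 * v1 + u1 * v2)) = A * (A0 * (m22' - m11'))"
      if "A * D * (u1 * v0 + u0 * v1) = A0 * (m22 - m11)" "A * D * (u1 * v1) = - A0 * m21"
        "A * m11' = A * m22 + z * m21" "A * m22' = A * m11 - z * m21"
        "A' * u2 = z * u1 - A * u0" "A' * v2 = z * v1 - A * v0"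
      for A A' A0 D u0 u1 u2 v0 v1 v2 m11 m22 m21 m11' m22' :: complex
    proof -
      have "A * (A' * D * (u2 * v1 + u1 * v2)) = A * D * ((A' * u2) * v1 + u1 * (A' * v2))"
        by (simp add: algebra_simps)
      also have "\<dots> = 2 * z * (A * D * (u1 * v1)) - A * (A * D * (u1 * v0 + u0 * v1))"
        unfolding that(5,6) by (simp add: algebra_simps)
      also have "\<dots> = A0 * (A * m22' - A * m11')"
        unfolding that(1-4) by (simp add: algebra_simps)
      finally show ?thesis
        by (simp add: algebra_simps)
    qed
    from this[OF Suc(2,3) sh(2,3) u v] show ?thesis .
  qed
  then show "complex_of_real (a (Suc s)) * sol a z 0 1 T *
      (u (Suc (Suc s)) * v (Suc s) + u (Suc s) * v (Suc (Suc s))) =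
      complex_of_real (a 0) * (sol (b (Suc s)) z 0 1 (Suc T) - sol (b (Suc s)) z 1 0 T)"
    using nz by (simp only: mult_cancel_left) simp
  have "complex_of_real (a s) * complex_of_real (a (Suc s)) * (complex_of_real (a (Suc s)) * sol a z 0 1 T *
      (u (Suc (Suc s)) * v (Suc (Suc s)))) =
      complex_of_real (a s) * complex_of_real (a (Suc s)) *
        (- complex_of_real (a 0) * sol (b (Suc s)) z 1 0 (Suc T))"
  proof -
    have "A * A' * (A' * D * (u2 * v2)) = A * A' * (- A0 * m21')"
      if "A * D * (u0 * v0) = A0 * m12" "A * D * (u1 * v0 + u0 * v1) = A0 * (m22 - m11)"
        "A * D * (u1 * v1) = - A0 * m21"
        "A * A' * m21' = z * (A * (m22 - m11) + z * m21) - A\<^sup>2 * m12"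
        "A' * u2 = z * u1 - A * u0" "A' * v2 = z * v1 - A * v0"
      for A A' A0 D u0 u1 u2 v0 v1 v2 m11 m12 m22 m21 m21' :: complex
    proof -
      have "A * A' * (A' * D * (u2 * v2)) = A * D * ((A' * u2) * (A' * v2))"
        by (simp add: algebra_simps)
      also have "\<dots> = z\<^sup>2 * (A * D * (u1 * v1)) - z * A * (A * D * (u1 * v0 + u0 * v1)) +
          A\<^sup>2 * (A * D * (u0 * v0))"
        unfolding that(5,6) by (simp add: algebra_simps power2_eq_square)
      also have "\<dots> = - A0 * (A * A' * m21')"
        unfolding that(1-4) by (simp add: algebra_simps power2_eq_square)
      finally show ?thesis
        by (simp add: algebra_simps)
    qed
    from this[OF Suc sh(4) u v] show ?thesis .
  qed
  then show "complex_of_real (a (Suc s)) * sol a z 0 1 T * (u (Suc (Suc s)) * v (Suc (Suc s))) =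
      - complex_of_real (a 0) * sol (b (Suc s)) z 1 0 (Suc T)"
    using nz by (simp only: mult_cancel_left mult_eq_0_iff) simp
qed

section \<open>The rational function that extends \<open>C\<close>\<close>

definition C_num :: "complex poly" where
  "C_num = (\<Sum>s<T. smult (complex_of_real (a 0 / (2 * a s)))
     (sol_poly (\<lambda>k. a (k + s)) 0 1 (Suc T) - sol_poly (\<lambda>k. a (k + s)) 1 0 T))"

abbreviation C_fract :: "complex poly fract" where
  "C_fract \<equiv> Fract C_num (sol_poly a 0 1 T)"

text \<open>At a real \<open>z\<close> the conjugate of the Floquet solution is the one with slope
  \<open>cnj y\<close>, so the real part is half of the symmetric neighbour product given by
  \<open>floquet_products\<close>.\<close>

lemma C_ell_eq:
  assumes "z \<in> sigma_ell a T" "eigenvalue (monodromy a T z) \<mu>"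
  shows "complex_of_real (C_ell a T z \<mu>) = poly C_num z / sol a z 0 1 T"
proof -
  note e = elliptic_eigenvalue[OF assms]
  define y where "y = (\<mu> - sol a z 1 0 T) / sol a z 0 1 T"
  have real: "cnj (sol a z 1 0 n) = sol a z 1 0 n" "cnj (sol a z 0 1 n) = sol a z 0 1 n" for n :: nat
    using e(1) by (simp_all add: cnj_sol)
  have cy: "sol a z 0 1 T * y = \<mu> - sol a z 1 0 T" "sol a z 0 1 T * cnj y = cnj \<mu> - sol a z 1 0 T"
    using e(4) by (simp_all add: y_def real)
  have 1: "sol a z 0 1 T * (y + cnj y) = sol a z 0 1 (Suc T) - sol a z 1 0 T"
  proof -
    have "sol a z 0 1 T * (y + cnj y) = (\<mu> + cnj \<mu>) - 2 * sol a z 1 0 T"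
      by (simp only: distrib_left cy) simp
    then show ?thesis
      unfolding e(3) by simp
  qed
  \<comment> \<open>The extra factor \<open>m_12\<close> clears both denominators; trace and
    determinant then evaluate the product of the two numerators.\<close>
  have "sol a z 0 1 T * (sol a z 0 1 T * (y * cnj y)) = sol a z 0 1 T * (- sol a z 1 0 (Suc T))"
  proof -
    have "D * (D * (y * y')) = D * (- r)"
      if "D * y = \<mu> - p" "D * y' = \<mu>' - p" "\<mu>' * \<mu> = 1" "\<mu> + \<mu>' = p + s" "p * s - r * D = 1"
      for D y y' \<mu> \<mu>' p r s :: complex
    proof -
      have "D * (D * (y * y')) = (D * y) * (D * y')"
        by (simp add: algebra_simps)
      also have "\<dots> = \<mu>' * \<mu> - p * (\<mu> + \<mu>') + p * p"
        unfolding that(1,2) by (simp add: algebra_simps)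
      also have "\<dots> = D * (- r)"
        unfolding that(3,4) using that(5) by (simp add: algebra_simps)
      finally show ?thesis .
    qed
    from this[OF cy e(2,3) det_monodromy] show ?thesis .
  qed
  then have 2: "sol a z 0 1 T * (y * cnj y) = - sol a z 1 0 (Suc T)"
    using e(4) by (simp only: mult_cancel_left) simp
  define u v where "u = sol a z 1 y" and "v = sol a z 1 (cnj y)"
  have phi: "phi a T z \<mu> n = u n" and cphi: "cnj (u n) = v n" and cphi': "cnj (v n) = u n" for n
    using e(1) unfolding u_def v_def
    by (simp_all only: phi_eq_sol y_def monodromy_index cnj_sol complex_cnj_one complex_cnj_cnj)
  have "complex_of_real (C_ell a T z \<mu>) = complex_of_real (Re (\<Sum>s<T. u (Suc s) * v s))"
    unfolding C_ell_def phi cphi by (simp add: sum.atLeast1_atMost_eq)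
  also have "\<dots> = (\<Sum>s<T. u (Suc s) * v s + u s * v (Suc s)) / 2"
  proof -
    have "complex_of_real (2 * Re w) = w + cnj w" for w
      by (simp add: complex_add_cnj)
    from this[of "\<Sum>s<T. u (Suc s) * v s"] show ?thesis
      by (simp add: cphi cphi' sum.distrib mult.commute)
  qed
  also have "\<dots> = (\<Sum>s<T. (complex_of_real (a 0 / (2 * a s)) *
      (sol (\<lambda>k. a (k + s)) z 0 1 (Suc T) - sol (\<lambda>k. a (k + s)) z 1 0 T)) / sol a z 0 1 T)"
    unfolding sum_divide_distrib
  proof (intro sum.cong refl)
    fix s
    show "(u (Suc s) * v s + u s * v (Suc s)) / 2 = (complex_of_real (a 0 / (2 * a s)) *
      (sol (\<lambda>k. a (k + s)) z 0 1 (Suc T) - sol (\<lambda>k. a (k + s)) z 1 0 T)) / sol a z 0 1 T"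
    proof -
      have "w / 2 = complex_of_real (x / (2 * y)) * m / D"
        if "complex_of_real y * D * w = complex_of_real x * m" "complex_of_real y \<noteq> 0" "D \<noteq> 0"
        for w m D x y
      proof -
        have "w = complex_of_real x * m / (complex_of_real y * D)"
          using that by (metis nonzero_mult_div_cancel_left mult_eq_0_iff)
        then show ?thesis
          by simp
      qed
      from this[OF floquet_products(2)[OF 1 2, of s, folded u_def v_def] _ e(4)] show ?thesis
        by simp
    qed
  qed
  also have "\<dots> = poly C_num z / sol a z 0 1 T"
    by (simp add: C_num_def poly_sum sol_def sum_divide_distrib del: sol_poly.simps)
  finally show ?thesis .
qed

lemma extends_C_fract: "extends_C a T C_fract"
  unfolding extends_C_def
proof (intro ballI)
  fix z assume z: "z \<in> sigma_ell a T"
  then obtain \<mu> where "eigenvalue (monodromy a T z) \<mu>"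
    unfolding sigma_ell_def by blast
  then have "sol a z 0 1 T \<noteq> 0"
    using elliptic_eigenvalue(4) z by blast
  then show "poly (ratfun_denom C_fract) z \<noteq> 0 \<and> (\<forall>\<mu>. eigenvalue (monodromy a T z) \<mu> \<longrightarrow>
      ratfun_eval C_fract z = complex_of_real (C_ell a T z \<mu>))"
    using z by (simp add: ratfun_eval_Fract C_ell_eq sol_def)
qed

lemma extends_C_unique:
  assumes "extends_C a T R" "extends_C a T R'"
  shows "R = R'"
proof (rule ratfun_eqI[OF infinite_sigma_ell])
  fix z assume z: "z \<in> sigma_ell a T"
  then obtain \<mu> where "eigenvalue (monodromy a T z) \<mu>"
    unfolding sigma_ell_def by blast
  then show "poly (ratfun_denom R) z \<noteq> 0 \<and> poly (ratfun_denom R') z \<noteq> 0 \<and>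
      ratfun_eval R z = ratfun_eval R' z"
    using assms z unfolding extends_C_def by metis
qed

lemma C_rat_eq: "C_rat a T = C_fract"
  unfolding C_rat_def using extends_C_fract extends_C_unique by blast

section \<open>Leading coefficients and the asymptotics\<close>

text \<open>Moving the window by one site trades a weight for the equal weight one period later.
  Hence all the \<open>m_22\<close> of the shifted weights share one leading coefficient.\<close>

lemma prod_shift: "(\<Prod>j=1..T. a (j + s)) = (\<Prod>j=1..T. a j)"
proof (induction s)
  case (Suc s)
  have "a (Suc s) * (\<Prod>j<T. a (Suc j + Suc s)) = (\<Prod>j<Suc T. a (j + Suc s))"
    by (subst prod.lessThan_Suc_shift) simp
  also have "\<dots> = a (Suc s) * (\<Prod>j<T. a (Suc j + s))"
    using periodic[of "Suc s"] by (simp add: ac_simps)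
  finally show ?case
    using Suc by (simp add: prod.atLeast1_atMost_eq)
qed simp

lemma degree_C_num: "degree C_num \<le> T"
  unfolding C_num_def
proof (intro degree_sum_le order.trans[OF degree_smult_le] degree_diff_le)
  show "degree (sol_poly (\<lambda>k. a (k + s)) 1 0 T) \<le> T" for s
    using degree_sol_poly[of "\<lambda>k. a (k + s)" 1 0 "T - 1"] T_pos by simp
qed (use degree_sol_poly in auto)

lemma coeff_C_num:
  "coeff C_num T = complex_of_real (1 / 2 * (\<Sum>j=1..T. inverse (a j))) * coeff (sol_poly a 0 1 T) (T - 1)"
proof -
  obtain m where m: "T = Suc m"
    using T_pos by (metis Suc_le_D One_nat_def)
  have "coeff (sol_poly b 1 0 T) T = 0" for b
    using degree_sol_poly[of b 1 0 m] m by (intro coeff_eq_0) simp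
  then have "coeff C_num T =
      (\<Sum>s<T. complex_of_real (a 0 / (2 * a s)) / complex_of_real (\<Prod>j=1..T. a j))"
    by (simp add: C_num_def coeff_sum coeff_sol_poly prod_shift del: sol_poly.simps of_real_prod One_nat_def)
  also have "\<dots> = complex_of_real (1 / 2 * (\<Sum>s<T. inverse (a s)) * (a 0 / (\<Prod>j=1..T. a j)))"
    by (simp add: sum_distrib_left sum_distrib_right field_simps del: of_real_prod)
  \<comment> \<open>As \<open>a 0 = a T\<close>, the last factor cancels; what remains is the
    leading coefficient of \<open>m_12\<close>.\<close>
  also have "a 0 / (\<Prod>j=1..T. a j) = 1 / (\<Prod>j=1..m. a j)"
    using m periodic_0 by simp
  also have "(\<Sum>s<T. inverse (a s)) = (\<Sum>j=1..T. inverse (a j))"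
    using sum.lessThan_Suc_shift[of "\<lambda>s. inverse (a s)" T] by (simp add: sum.atLeast1_atMost_eq)
  finally show ?thesis
    using coeff_sol_poly[of a 0 1 m] m by simp
qed

lemma C_rat_order_asymp:
  "ratfun_order (C_rat a T) = 1"
  "ratfun_eval (C_rat a T) \<sim>[at_infinity]
    (\<lambda>z. complex_of_real (1 / 2 * (\<Sum>j=1..T. inverse (a j))) * z)"
proof -
  let ?D = "sol_poly a 0 1 T" and ?c = "complex_of_real (1 / 2 * (\<Sum>j=1..T. inverse (a j)))"
  obtain m where m: "T = Suc m"
    using T_pos by (metis Suc_le_D One_nat_def)
  have D: "degree ?D \<le> m" "coeff ?D m \<noteq> 0"
    using m degree_sol_poly[of a 0 1 m] coeff_sol_poly[of a 0 1 m] by (simp_all del: sol_poly.simps)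
  \<comment> \<open>Positivity keeps the top coefficient of \<open>C_num\<close> from vanishing, so
    its degree is exactly \<open>T\<close>.\<close>
  have "(\<Sum>j=1..T. inverse (a j)) > 0"
    using T_pos a_pos by (intro sum_pos) auto
  then have c: "?c \<noteq> 0"
    by (metis of_real_eq_0_iff mult_eq_0_iff less_irrefl zero_neq_one divide_eq_0_iff zero_neq_numeral)
  have N: "coeff C_num (Suc m) = ?c * coeff ?D m" "degree C_num \<le> Suc m"
    using coeff_C_num degree_C_num m by simp_all
  have N_nz: "coeff C_num (Suc m) \<noteq> 0"
    unfolding N(1) using D(2) c by (metis mult_eq_0_iff)
  have "degree ?D = m" "degree C_num = Suc m"
    using D N(2) N_nz le_degree by (metis antisym)+
  moreover have "?D \<noteq> 0" "C_num \<noteq> 0"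
    using D(2) N_nz coeff_0 by metis+
  ultimately show "ratfun_order (C_rat a T) = 1"
    by (simp add: C_rat_eq ratfun_order_Fract)
  show "ratfun_eval (C_rat a T) \<sim>[at_infinity] (\<lambda>z. ?c * z)"
    unfolding C_rat_eq by (rule ratfun_asymp[OF N(2) D N(1) c])
qed

end

theorem theorem4p7:
  fixes a :: "nat \<Rightarrow> real" and T :: nat
  assumes "T \<ge> 1"
    and "\<And>j. j \<in> {1..T} \<Longrightarrow> a j > 0"
    and "\<And>n. a (n + T) = a n"
  shows "(\<exists>!R. extends_C a T R) \<and>
         ratfun_order (C_rat a T) = 1 \<and>
         ratfun_eval (C_rat a T) \<sim>[at_infinity]
           (\<lambda>z. complex_of_real (1 / 2 * (\<Sum>j=1..T. inverse (a j))) * z)"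
proof -
  \<comment> \<open>Positivity spreads from one period to all sites; site 0 gets it from
    \<open>a T\<close>.\<close>
  have "a n > 0" for n
  proof (induction n rule: less_induct)
    case (less n)
    show ?case
    proof (cases "n \<le> T")
      case True
      then show ?thesis
        using assms(1) assms(2)[of n] assms(2)[of T] assms(3)[of 0] by (cases n) auto
    next
      case False
      then show ?thesis
        using less[of "n - T"] assms(1) assms(3)[of "n - T"] by simp
    qed
  qed
  then interpret periodic_weights a T
    using assms by unfold_locales
  show ?thesis
    using extends_C_fract extends_C_unique C_rat_order_asymp by blast
qed

end
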